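(* Let $G$ be a discrete group, generated by a finite symmetric set $S$ and endowed with a length function denoted by $|\cdot|$. Let $\pi$ be a unitary representation of $G$ without almost invariant vectors and of non-trivial cohomology, i.e. $H^1(G,\pi)\neq 0$. Let $\mathcal{F}$ be the set of all functions $f:G\to\mathbb{R}$ such that $f\ge 0$, $f(e)=0$ and $\mathcal{L}f\equiv 1$. If $\rho_-(t)$ is the lower control function of a $\pi$-equivariant embedding, then there exists a function $f\in\mathcal{F}$ so that $\rho_-(t)$ is bounded (above and below, up to multiplicative and additive constants) by $\min\{\sqrt{f(g)} : |g|=t\}$, uniformly on $t$.
   Context: The Laplace operator is that of the Cayley graph of $G$ with respect to $S$: $\mathcal{L}f(g)=\left(\frac{1}{|S|}\sum_{s\in S}f(gs)\right)-f(g)$, where $|S|$ is the cardinality of $S$. The group $G$ carries the metric $d_G(x,y)=|x^{-1}y|$ given by the length function. "Uniformly on $t$" means that the multiplicative and additive constants do not depend on $t$. For a unitary representation $\pi$ of $G$ on a Hilbert space $\mathcal{H}$, a cocycle is a map $b:G\to\mathcal{H}$ with $b(gh)=\pi(g)b(h)+b(g)$ for all $g,h\in G$; a coboundary is a cocycle of the form $g\mapsto(\pi(g)-1)v$ with $v\in\mathcal{H}$; $H^1(G,\pi)$ is the quotient of the space of cocycles by the space of coboundaries. The representation $\pi$ has almost invariant vectors if for every finite set $A\subset G$ and every $\epsilon>0$ there is a unit vector $v\in\mathcal{H}$ with $\|\pi(g)v-v\|<\epsilon$ for all $g\in A$. A map $F:G\to\mathcal{H}$ is a coarse embedding if there are control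 functions $\rho_\pm:\mathbb{R}^+\to\mathbb{R}^+$ with $\lim_{t\to+\infty}\rho_\pm(t)=+\infty$ and $\rho_-(d_G(x,y))\le\|F(x)-F(y)\|\le\rho_+(d_G(x,y))$ for all $x,y\in G$; $\rho_-$ is the lower control function. A $\pi$-equivariant embedding is a coarse embedding which is equivariant for an affine isometric action of $G$ on $\mathcal{H}$ with linear part $\pi$; up to a translation, such an $F$ is a cocycle for $\pi$.
   Formalization: The length function is assumed unbounded when G is infinite (automatic for word or proper lengths; the claim fails otherwise); ρ_- is taken to be the largest lower control function, t ranges over values of the length, and min is read as an infimum on infinite spheres. *)

theory Defs
  imports "HOL-Analysis.Analysis" "HOL-Algebra.Generated_Groups"
begin

(* A complex Hilbert space, layered over the library's real Hilbert spaces: the real inner product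
   is the real part of the Hermitian one, so that positivity, the norm and the topology are those
   of the underlying real space.  cinner is linear in the first argument. *)
class complex_hilbert_space = real_inner + complete_space +
  fixes scaleC :: "complex \<Rightarrow> 'a \<Rightarrow> 'a"
    and cinner :: "'a \<Rightarrow> 'a \<Rightarrow> complex"
  assumes scaleC_add_right: "scaleC c (x + y) = scaleC c x + scaleC c y"
    and scaleC_add_left: "scaleC (c + d) x = scaleC c x + scaleC d x"
    and scaleC_scaleC: "scaleC c (scaleC d x) = scaleC (c * d) x"
    and scaleC_of_real: "scaleC (complex_of_real r) x = scaleR r x"
    and cinner_commute: "cinner x y = cnj (cinner y x)"
    and cinner_add_left: "cinner (x + y) z = cinner x z + cinner y z"
    and cinner_scaleC_left: "cinner (scaleC c x) y = c * cinner x y"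
    and Re_cinner: "Re (cinner x y) = inner x y"

definition unitary_operator :: "('h::complex_hilbert_space \<Rightarrow> 'h) \<Rightarrow> bool" where
  "unitary_operator U \<longleftrightarrow>
     (\<forall>x y. U (x + y) = U x + U y) \<and> (\<forall>c x. U (scaleC c x) = scaleC c (U x)) \<and>
     (\<forall>x y. cinner (U x) (U y) = cinner x y) \<and> surj U"

(* pi 1 = id follows, since pi 1 is an idempotent bijection. *)
definition unitary_rep ::
    "('g, 'm) monoid_scheme \<Rightarrow> ('g \<Rightarrow> 'h::complex_hilbert_space \<Rightarrow> 'h) \<Rightarrow> bool" where
  "unitary_rep G \<pi> \<longleftrightarrow>
     (\<forall>g\<in>carrier G. unitary_operator (\<pi> g)) \<and>
     (\<forall>g\<in>carrier G. \<forall>h\<in>carrier G. \<pi> (g \<otimes>\<^bsub>G\<^esub> h) = \<pi> g \<circ> \<pi> h)"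

definition almost_invariant_vectors ::
    "('g, 'm) monoid_scheme \<Rightarrow> ('g \<Rightarrow> 'h::complex_hilbert_space \<Rightarrow> 'h) \<Rightarrow> bool" where
  "almost_invariant_vectors G \<pi> \<longleftrightarrow>
     (\<forall>A \<epsilon>. finite A \<and> A \<subseteq> carrier G \<and> (\<epsilon>::real) > 0 \<longrightarrow>
        (\<exists>v. norm v = 1 \<and> (\<forall>g\<in>A. norm (\<pi> g v - v) < \<epsilon>)))"

(* Values outside carrier G are irrelevant and left unconstrained.  Two functions that agree on
   the carrier differ by an element of coboundaries, so H1 below does not see these values. *)
definition cocycles ::
    "('g, 'm) monoid_scheme \<Rightarrow> ('g \<Rightarrow> 'h::complex_hilbert_space \<Rightarrow> 'h) \<Rightarrow> ('g \<Rightarrow> 'h) set" where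
  "cocycles G \<pi> = {b. \<forall>g\<in>carrier G. \<forall>h\<in>carrier G. b (g \<otimes>\<^bsub>G\<^esub> h) = \<pi> g (b h) + b g}"

definition coboundaries ::
    "('g, 'm) monoid_scheme \<Rightarrow> ('g \<Rightarrow> 'h::complex_hilbert_space \<Rightarrow> 'h) \<Rightarrow> ('g \<Rightarrow> 'h) set" where
  "coboundaries G \<pi> = {b. \<exists>v. \<forall>g\<in>carrier G. b g = \<pi> g v - v}"

(* The zero element of this quotient is the class of the zero cocycle, i.e. coboundaries G pi. *)
definition H1 ::
    "('g, 'm) monoid_scheme \<Rightarrow> ('g \<Rightarrow> 'h::complex_hilbert_space \<Rightarrow> 'h) \<Rightarrow> ('g \<Rightarrow> 'h) set set" where
  "H1 G \<pi> = cocycles G \<pi> //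
     {(b, b'). b \<in> cocycles G \<pi> \<and> b' \<in> cocycles G \<pi> \<and> (\<lambda>g. b g - b' g) \<in> coboundaries G \<pi>}"

definition length_function :: "('g, 'm) monoid_scheme \<Rightarrow> ('g \<Rightarrow> real) \<Rightarrow> bool" where
  "length_function G len \<longleftrightarrow>
     (\<forall>g\<in>carrier G. len g \<ge> 0 \<and> (len g = 0 \<longleftrightarrow> g = \<one>\<^bsub>G\<^esub>) \<and> len (inv\<^bsub>G\<^esub> g) = len g) \<and>
     (\<forall>g\<in>carrier G. \<forall>h\<in>carrier G. len (g \<otimes>\<^bsub>G\<^esub> h) \<le> len g + len h)"

definition group_dist :: "('g, 'm) monoid_scheme \<Rightarrow> ('g \<Rightarrow> real) \<Rightarrow> 'g \<Rightarrow> 'g \<Rightarrow> real" where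
  "group_dist G len x y = len (inv\<^bsub>G\<^esub> x \<otimes>\<^bsub>G\<^esub> y)"

definition laplacian :: "('g, 'm) monoid_scheme \<Rightarrow> 'g set \<Rightarrow> ('g \<Rightarrow> real) \<Rightarrow> 'g \<Rightarrow> real" where
  "laplacian G S f g = (1 / real (card S)) * (\<Sum>s\<in>S. f (g \<otimes>\<^bsub>G\<^esub> s)) - f g"

definition laplace_solutions :: "('g, 'm) monoid_scheme \<Rightarrow> 'g set \<Rightarrow> ('g \<Rightarrow> real) set" where
  "laplace_solutions G S =
     {f. (\<forall>g\<in>carrier G. f g \<ge> 0) \<and> f \<one>\<^bsub>G\<^esub> = 0 \<and> (\<forall>g\<in>carrier G. laplacian G S f g = 1)}"

(* Control functions are maps from [0,oo) to [0,oo); their values at negative reals play no role. *)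
definition control_functions ::
    "('g, 'm) monoid_scheme \<Rightarrow> ('g \<Rightarrow> real) \<Rightarrow> ('g \<Rightarrow> 'h::complex_hilbert_space) \<Rightarrow>
     (real \<Rightarrow> real) \<Rightarrow> (real \<Rightarrow> real) \<Rightarrow> bool" where
  "control_functions G len F \<rho>m \<rho>p \<longleftrightarrow>
     (\<forall>t\<ge>0. \<rho>m t \<ge> 0 \<and> \<rho>p t \<ge> 0) \<and>
     filterlim \<rho>m at_top at_top \<and> filterlim \<rho>p at_top at_top \<and>
     (\<forall>x\<in>carrier G. \<forall>y\<in>carrier G.
        \<rho>m (group_dist G len x y) \<le> norm (F x - F y) \<and>
        norm (F x - F y) \<le> \<rho>p (group_dist G len x y))"

definition coarse_embedding ::
    "('g, 'm) monoid_scheme \<Rightarrow> ('g \<Rightarrow> real) \<Rightarrow> ('g \<Rightarrow> 'h::complex_hilbert_space) \<Rightarrow> bool" where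
  "coarse_embedding G len F \<longleftrightarrow> (\<exists>\<rho>m \<rho>p. control_functions G len F \<rho>m \<rho>p)"

(* "The" lower control function is the largest one: an arbitrary admissible rho_- may grow
   arbitrarily slowly, and no lower bound on it could hold.  Maximality is only meaningful at the
   values t taken by the length, since at other t the function is not constrained from above. *)
definition lower_control_function ::
    "('g, 'm) monoid_scheme \<Rightarrow> ('g \<Rightarrow> real) \<Rightarrow> ('g \<Rightarrow> 'h::complex_hilbert_space) \<Rightarrow>
     (real \<Rightarrow> real) \<Rightarrow> bool" where
  "lower_control_function G len F \<rho> \<longleftrightarrow>
     (\<exists>\<rho>p. control_functions G len F \<rho> \<rho>p) \<and>
     (\<forall>\<rho>' \<rho>p'. control_functions G len F \<rho>' \<rho>p' \<longrightarrow> (\<forall>t\<in>len ` carrier G. \<rho>' t \<le> \<rho> t))"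

(* Such an action is isometric as soon as pi is unitary. *)
definition affine_action ::
    "('g, 'm) monoid_scheme \<Rightarrow> ('g \<Rightarrow> 'h::complex_hilbert_space \<Rightarrow> 'h) \<Rightarrow> ('g \<Rightarrow> 'h \<Rightarrow> 'h) \<Rightarrow> bool" where
  "affine_action G \<pi> \<alpha> \<longleftrightarrow>
     \<alpha> \<one>\<^bsub>G\<^esub> = id \<and>
     (\<forall>g\<in>carrier G. \<forall>h\<in>carrier G. \<alpha> (g \<otimes>\<^bsub>G\<^esub> h) = \<alpha> g \<circ> \<alpha> h) \<and>
     (\<forall>g\<in>carrier G. \<exists>w. \<forall>v. \<alpha> g v = \<pi> g v + w)"

definition equivariant_embedding ::
    "('g, 'm) monoid_scheme \<Rightarrow> ('g \<Rightarrow> real) \<Rightarrow> ('g \<Rightarrow> 'h::complex_hilbert_space \<Rightarrow> 'h) \<Rightarrow>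
     ('g \<Rightarrow> 'h) \<Rightarrow> bool" where
  "equivariant_embedding G len \<pi> F \<longleftrightarrow>
     coarse_embedding G len F \<and>
     (\<exists>\<alpha>. affine_action G \<pi> \<alpha> \<and>
        (\<forall>g\<in>carrier G. \<forall>x\<in>carrier G. F (g \<otimes>\<^bsub>G\<^esub> x) = \<alpha> g (F x)))"

(* Over an infinite sphere (possible when the length is not proper) the minimum is read as an
   infimum; for a word length, or any proper length, it is a minimum over a finite set. *)
definition sphere_min :: "('g, 'm) monoid_scheme \<Rightarrow> ('g \<Rightarrow> real) \<Rightarrow> ('g \<Rightarrow> real) \<Rightarrow> real \<Rightarrow> real" where
  "sphere_min G len f t = Inf {sqrt (f g) | g. g \<in> carrier G \<and> len g = t}"

end

theory Submission
  imports Defs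
begin

text \<open>
  The idea is to replace the given equivariant embedding by a harmonic one at bounded distance.
  Up to a translation the embedding is a cocycle \<open>b\<close>. Because \<open>\<pi>\<close> has no almost invariant
  vectors, the displacement energy \<open>\<Sum>s\<in>S. \<parallel>\<pi> s v - v\<parallel>\<^sup>2\<close> dominates a multiple of
  \<open>\<parallel>v\<parallel>\<^sup>2\<close> (\<open>spectral_gap\<close>). The energy is twice the quadratic form of the operator
  \<open>T v = (\<Sum>s\<in>S. v - \<pi> s v)\<close>, so \<open>T\<close> is coercive, hence onto (\<open>coercive_operator_surj\<close>).
  Solving \<open>T v = (\<Sum>s\<in>S. b s)\<close> and adding the coboundary of \<open>v\<close> to \<open>b\<close> produces a cocycle \<open>h\<close>
  with \<open>(\<Sum>s\<in>S. h s) = 0\<close>, that is, a harmonic one (\<open>harmonic_representative\<close>).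

  For such an \<open>h\<close> the cross terms in \<open>\<parallel>h (g s)\<parallel>\<^sup>2 = \<parallel>h g + \<pi> g (h s)\<parallel>\<^sup>2\<close> cancel on summing over
  \<open>S\<close>, so \<open>\<parallel>h\<parallel>\<^sup>2\<close> has constant Laplacian, the mean of \<open>\<parallel>h s\<parallel>\<^sup>2\<close> over \<open>S\<close>
  (\<open>laplacian_harmonic_cocycle\<close>). If this constant were zero, \<open>h\<close> would vanish and \<open>b\<close> would be
  a bounded function; a bounded coarse embedding forces lengths to be bounded, hence \<open>G\<close> to be
  finite, and finite groups have no cohomology (\<open>H1_finite\<close>). So a rescaling of \<open>\<parallel>h\<parallel>\<^sup>2\<close> is the desired \<open>f\<close>, and \<open>sqrt f\<close> is
  proportional to \<open>\<parallel>b\<parallel>\<close> up to an additive error of at most a multiple of \<open>2 * \<parallel>v\<parallel>\<close>. The largest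
  lower control function is the infimum of \<open>\<parallel>b\<parallel>\<close> over spheres (\<open>lower_control_function_greatest\<close>),
  and the two-sided bound passes to these infima.
\<close>

section \<open>Coercive operators\<close>

text \<open>
  The Lax--Milgram argument: for a coercive bounded operator and a small enough step \<open>r\<close>, the map
  \<open>x \<mapsto> x - r (T x - w)\<close> is a contraction, and its fixed point solves the equation.
\<close>

lemma coercive_operator_surj:
  fixes T :: "'a::{real_inner, complete_space} \<Rightarrow> 'a"
  assumes "bounded_linear T" and "\<alpha> > 0"
    and coercive: "\<And>v. \<alpha> * (norm v)\<^sup>2 \<le> inner (T v) v"
  shows "surj T"
proof -
  interpret T: bounded_linear T by fact
  obtain B where B: "B > 0" "\<And>v. norm (T v) \<le> norm v * B"
    using T.pos_bounded by blast
  \<comment> \<open>\<open>\<beta>\<close> enlarges the bound \<open>B\<close> so that \<open>q\<close>, the square of the contraction factor, is nonnegative.\<close>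
  define \<beta> where "\<beta> = B + \<alpha>"
  define r where "r = \<alpha> / \<beta>\<^sup>2"
  define q where "q = 1 - \<alpha>\<^sup>2 / \<beta>\<^sup>2"
  have \<beta>: "\<beta> > 0" "\<alpha> < \<beta>" using B(1) \<open>\<alpha> > 0\<close> by (auto simp: \<beta>_def)
  have r: "r > 0" using \<beta> \<open>\<alpha> > 0\<close> by (simp add: r_def)
  have "\<alpha>\<^sup>2 < \<beta>\<^sup>2" using \<beta> \<open>\<alpha> > 0\<close> by (intro power_strict_mono) auto
  hence q: "0 \<le> q" "q < 1" using \<beta> \<open>\<alpha> > 0\<close> by (auto simp: q_def)
  have contract: "norm (v - r *\<^sub>R T v) \<le> sqrt q * norm v" for v
  proof -
    have "norm (T v) \<le> \<beta> * norm v"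
      using B(2)[of v] \<open>\<alpha> > 0\<close> by (simp add: \<beta>_def algebra_simps add_increasing2)
    hence "(norm (T v))\<^sup>2 \<le> \<beta>\<^sup>2 * (norm v)\<^sup>2"
      by (metis norm_ge_zero power_mono power_mult_distrib)
    hence Tv: "r\<^sup>2 * (norm (T v))\<^sup>2 \<le> r\<^sup>2 * (\<beta>\<^sup>2 * (norm v)\<^sup>2)"
      by (intro mult_left_mono) auto
    have "(norm (v - r *\<^sub>R T v))\<^sup>2 = (norm v)\<^sup>2 - 2 * r * inner (T v) v + r\<^sup>2 * (norm (T v))\<^sup>2"
      unfolding power2_norm_eq_inner
      by (simp add: inner_diff_left inner_diff_right inner_commute power2_eq_square algebra_simps)
    also have "\<dots> \<le> (norm v)\<^sup>2 - 2 * r * (\<alpha> * (norm v)\<^sup>2) + r\<^sup>2 * (\<beta>\<^sup>2 * (norm v)\<^sup>2)"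
      using mult_left_mono[OF coercive[of v], of "2 * r"] r
      by (intro add_mono diff_left_mono Tv) auto
    also have "\<dots> = q * (norm v)\<^sup>2"
    proof -
      have "r\<^sup>2 * \<beta>\<^sup>2 = r * \<alpha>" and q_eq: "q = 1 - r * \<alpha>"
        using \<beta> by (auto simp: q_def r_def power2_eq_square field_simps)
      hence "r\<^sup>2 * (\<beta>\<^sup>2 * (norm v)\<^sup>2) = r * \<alpha> * (norm v)\<^sup>2" by (metis mult.assoc)
      thus ?thesis by (simp add: q_eq algebra_simps)
    qed
    finally have "norm (v - r *\<^sub>R T v) \<le> sqrt (q * (norm v)\<^sup>2)"
      by (rule real_le_rsqrt)
    thus ?thesis by (simp add: real_sqrt_mult)
  qed
  have "\<exists>v. T v = w" for w
  proof -
    have "\<exists>!v. v - r *\<^sub>R (T v - w) = v"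
    proof (rule banach_fix_type, safe)
      show "0 \<le> sqrt q" "sqrt q < 1" using q by auto
      fix x y :: 'a
      have "(x - r *\<^sub>R (T x - w)) - (y - r *\<^sub>R (T y - w)) = (x - y) - r *\<^sub>R T (x - y)"
        by (simp add: T.diff algebra_simps)
      thus "dist (x - r *\<^sub>R (T x - w)) (y - r *\<^sub>R (T y - w)) \<le> sqrt q * dist x y"
        using contract[of "x - y"] by (simp only: dist_norm)
    qed
    thus ?thesis using r by auto
  qed
  thus ?thesis by (metis surjI)
qed


section \<open>Unitary representations and their cocycles\<close>

locale unitary_representation = group G
  for G :: "('g, 'm) monoid_scheme" (structure) +
  fixes \<pi> :: "'g \<Rightarrow> 'h::complex_hilbert_space \<Rightarrow> 'h"
  assumes unitary_rep: "unitary_rep G \<pi>"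
begin

lemma rep_add: "g \<in> carrier G \<Longrightarrow> \<pi> g (x + y) = \<pi> g x + \<pi> g y"
  using unitary_rep by (simp add: unitary_rep_def unitary_operator_def)

lemma rep_scaleR: "g \<in> carrier G \<Longrightarrow> \<pi> g (r *\<^sub>R x) = r *\<^sub>R \<pi> g x"
  using unitary_rep by (simp add: unitary_rep_def unitary_operator_def flip: scaleC_of_real)

lemma rep_mult: "g \<in> carrier G \<Longrightarrow> h \<in> carrier G \<Longrightarrow> \<pi> (g \<otimes> h) v = \<pi> g (\<pi> h v)"
  using unitary_rep by (simp add: unitary_rep_def)

lemma rep_inner: "g \<in> carrier G \<Longrightarrow> inner (\<pi> g x) (\<pi> g y) = inner x y"
  using unitary_rep by (simp add: unitary_rep_def unitary_operator_def flip: Re_cinner)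

lemma rep_norm: "g \<in> carrier G \<Longrightarrow> norm (\<pi> g x) = norm x"
  by (simp add: norm_eq_sqrt_inner rep_inner)

lemma rep_linear: "g \<in> carrier G \<Longrightarrow> linear (\<pi> g)"
  by (intro linearI rep_add rep_scaleR)

lemma rep_zero: "g \<in> carrier G \<Longrightarrow> \<pi> g 0 = 0"
  by (rule linear_0[OF rep_linear])

lemma rep_diff: "g \<in> carrier G \<Longrightarrow> \<pi> g (x - y) = \<pi> g x - \<pi> g y"
  by (rule linear_diff[OF rep_linear])

lemma rep_sum: "g \<in> carrier G \<Longrightarrow> \<pi> g (\<Sum>i\<in>I. x i) = (\<Sum>i\<in>I. \<pi> g (x i))"
  by (rule linear_sum[OF rep_linear])

lemma rep_bounded_linear: "g \<in> carrier G \<Longrightarrow> bounded_linear (\<pi> g)"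
  by (rule bounded_linear_intro[where K = 1]) (auto simp: rep_add rep_scaleR rep_norm)

lemma rep_one: "\<pi> \<one> v = v"
proof -
  have "\<pi> \<one> (\<pi> \<one> v - v) = 0"
    using rep_mult[of \<one> \<one> v] by (simp add: rep_diff)
  hence "norm (\<pi> \<one> v - v) = 0" using rep_norm[of \<one> "\<pi> \<one> v - v"] by simp
  thus ?thesis by simp
qed

lemma cocycleD:
  "b \<in> cocycles G \<pi> \<Longrightarrow> g \<in> carrier G \<Longrightarrow> h \<in> carrier G \<Longrightarrow> b (g \<otimes> h) = \<pi> g (b h) + b g"
  by (simp add: cocycles_def)

lemma cocycle_one: "b \<in> cocycles G \<pi> \<Longrightarrow> b \<one> = 0"
  using cocycleD[of b \<one> \<one>] by (simp add: rep_one)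

lemma coboundaries_subset_cocycles: "coboundaries G \<pi> \<subseteq> cocycles G \<pi>"
  by (auto simp: coboundaries_def cocycles_def rep_diff rep_mult)

lemma cocycle_add_coboundary:
  assumes "b \<in> cocycles G \<pi>"
  shows "(\<lambda>g. b g + (\<pi> g v - v)) \<in> cocycles G \<pi>"
  using assms by (auto simp: cocycles_def rep_add rep_diff rep_mult)

lemma cocycle_eq_zero_on_generate:
  assumes "h \<in> cocycles G \<pi>" and "S \<subseteq> carrier G" and "\<And>s. s \<in> S \<Longrightarrow> h s = 0"
    and "g \<in> generate G S"
  shows "h g = 0"
  using assms(4)
proof induction
  case one
  thus ?case using assms(1) by (rule cocycle_one)
next
  case (incl s)
  thus ?case by (rule assms(3))
next
  case (inv s)
  hence "s \<in> carrier G" using assms(2) by auto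
  hence "h \<one> = \<pi> (inv s) (h s) + h (inv s)"
    using cocycleD[OF assms(1), of "inv s" s] by simp
  thus ?case using inv \<open>s \<in> carrier G\<close> cocycle_one[OF assms(1)] assms(3) by (simp add: rep_zero)
next
  case (eng g1 g2)
  thus ?case using cocycleD[OF assms(1), of g1 g2] generate_in_carrier[OF assms(2)]
    by (simp add: rep_zero)
qed

text \<open>
  Averaging the affine action of a cocycle over a finite group produces a fixed point, which
  exhibits the cocycle as a coboundary.
\<close>

lemma finite_cocycle_is_coboundary:
  assumes "finite (carrier G)" and b: "b \<in> cocycles G \<pi>"
  shows "b \<in> coboundaries G \<pi>"
proof -
  define n where "n = real (card (carrier G))"
  have n: "n > 0" using assms(1) one_closed by (auto simp: n_def card_gt_0_iff)
  define w where "w = (\<Sum>h\<in>carrier G. b h)"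
  define v where "v = - (1 / n) *\<^sub>R w"
  have "b g = \<pi> g v - v" if g: "g \<in> carrier G" for g
  proof -
    have "w = (\<Sum>h\<in>carrier G. b (g \<otimes> h))"
      unfolding w_def by (rule sum.reindex_bij_witness[of _ "\<lambda>h. g \<otimes> h" "\<lambda>h. inv g \<otimes> h"])
        (use g in \<open>auto simp flip: m_assoc\<close>)
    also have "\<dots> = \<pi> g w + n *\<^sub>R b g"
      using g cocycleD[OF b g] by (simp add: sum.distrib rep_sum w_def n_def flip: sum_constant_scaleR)
    finally have "n *\<^sub>R b g = w - \<pi> g w" by (simp add: algebra_simps)
    hence "(1 / n) *\<^sub>R (n *\<^sub>R b g) = (1 / n) *\<^sub>R (w - \<pi> g w)" by simp
    thus ?thesis using n rep_scaleR[OF g, of "- (1 / n)" w] by (simp add: v_def algebra_simps)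
  qed
  thus ?thesis by (auto simp: coboundaries_def)
qed

lemma coboundaries_diff:
  assumes "b \<in> coboundaries G \<pi>" "b' \<in> coboundaries G \<pi>"
  shows "(\<lambda>g. b g - b' g) \<in> coboundaries G \<pi>"
proof -
  obtain v v' where "\<forall>g\<in>carrier G. b g = \<pi> g v - v" "\<forall>g\<in>carrier G. b' g = \<pi> g v' - v'"
    using assms by (auto simp: coboundaries_def)
  hence "\<forall>g\<in>carrier G. b g - b' g = \<pi> g (v - v') - (v - v')" by (simp add: rep_diff)
  thus ?thesis by (auto simp: coboundaries_def)
qed

lemma H1_finite:
  assumes "finite (carrier G)"
  shows "H1 G \<pi> = {coboundaries G \<pi>}"
proof -
  have eq: "cocycles G \<pi> = coboundaries G \<pi>"
    using finite_cocycle_is_coboundary[OF assms] coboundaries_subset_cocycles by blast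
  have "(\<lambda>g. 0) \<in> coboundaries G \<pi>"
    by (auto simp: coboundaries_def rep_zero intro!: exI[of _ 0])
  thus ?thesis
    unfolding H1_def quotient_def eq using coboundaries_diff by blast
qed


section \<open>The spectral gap and harmonic representatives\<close>

text \<open>
  The displacement energy controls the displacement of \<open>v\<close> by every group element, with a
  constant depending on the length of a word representing it. This allows the finite set in the
  definition of almost invariant vectors to be replaced by the generating set.
\<close>

lemma displacement_le_energy:
  assumes "finite S" and "S \<subseteq> carrier G" and "g \<in> generate G S"
  shows "\<exists>C\<ge>0. \<forall>v. norm (\<pi> g v - v) \<le> C * sqrt (\<Sum>s\<in>S. (norm (\<pi> s v - v))\<^sup>2)"
    (is "\<exists>C\<ge>0. \<forall>v. _ \<le> C * ?E v")
proof -
  have gen: "norm (\<pi> s v - v) \<le> ?E v" if "s \<in> S" for s v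
    by (intro real_le_rsqrt member_le_sum) (use that assms(1) in auto)
  show ?thesis using assms(3)
  proof induction
    case one
    show ?case by (auto simp: rep_one)
  next
    case (incl s)
    thus ?case using gen by (intro exI[of _ 1]) auto
  next
    case (inv s)
    hence s: "s \<in> carrier G" using assms(2) by auto
    have "norm (\<pi> (inv s) v - v) = norm (\<pi> s v - v)" for v
    proof -
      have "\<pi> s (\<pi> (inv s) v - v) = v - \<pi> s v"
        using s by (simp add: rep_diff rep_one flip: rep_mult)
      thus ?thesis using rep_norm[OF s] by (metis norm_minus_commute)
    qed
    thus ?case using gen inv by (intro exI[of _ 1]) auto
  next
    case (eng g h)
    then obtain C D where C: "C \<ge> 0" "\<And>v. norm (\<pi> g v - v) \<le> C * ?E v"
      and D: "D \<ge> 0" "\<And>v. norm (\<pi> h v - v) \<le> D * ?E v" by blast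
    have gh: "g \<in> carrier G" "h \<in> carrier G"
      using eng.hyps generate_in_carrier[OF assms(2)] by auto
    have "norm (\<pi> (g \<otimes> h) v - v) \<le> (C + D) * ?E v" for v
    proof -
      have "\<pi> (g \<otimes> h) v - v = \<pi> g (\<pi> h v - v) + (\<pi> g v - v)"
        using gh by (simp add: rep_mult rep_diff)
      hence "norm (\<pi> (g \<otimes> h) v - v) \<le> norm (\<pi> h v - v) + norm (\<pi> g v - v)"
        using norm_triangle_ineq[of "\<pi> g (\<pi> h v - v)" "\<pi> g v - v"]
        by (simp only: rep_norm[OF gh(1)])
      thus ?thesis using C(2)[of v] D(2)[of v] by (simp add: algebra_simps)
    qed
    thus ?case using C(1) D(1) by (intro exI[of _ "C + D"]) auto
  qed
qed

lemma spectral_gap: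
  assumes "finite S" and "S \<subseteq> carrier G" and "generate G S = carrier G"
    and "\<not> almost_invariant_vectors G \<pi>"
  shows "\<exists>\<kappa>>0. \<forall>v. \<kappa> * (norm v)\<^sup>2 \<le> (\<Sum>s\<in>S. (norm (\<pi> s v - v))\<^sup>2)"
proof -
  define E where "E v = (\<Sum>s\<in>S. (norm (\<pi> s v - v))\<^sup>2)" for v
  have E_nonneg: "E v \<ge> 0" for v by (simp add: E_def sum_nonneg)
  obtain A \<epsilon> where A: "finite A" "A \<subseteq> carrier G" and \<epsilon>: "\<epsilon> > 0"
    and far: "\<And>v. norm v = 1 \<Longrightarrow> \<exists>g\<in>A. norm (\<pi> g v - v) \<ge> \<epsilon>"
    using assms(4) unfolding almost_invariant_vectors_def by (meson not_less)
  have "\<forall>g\<in>A. \<exists>C\<ge>0. \<forall>v. norm (\<pi> g v - v) \<le> C * sqrt (E v)"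
    using displacement_le_energy[OF assms(1,2)] assms(3) A(2) unfolding E_def by blast
  then obtain C where C: "\<And>g. g \<in> A \<Longrightarrow> C g \<ge> 0"
    "\<And>g v. g \<in> A \<Longrightarrow> norm (\<pi> g v - v) \<le> C g * sqrt (E v)" by metis
  define M where "M = 1 + (\<Sum>g\<in>A. C g)"
  have M: "M > 0" using C(1) by (simp add: M_def sum_nonneg add_pos_nonneg)
  have unit: "(\<epsilon> / M)\<^sup>2 \<le> E v" if v: "norm v = 1" for v
  proof -
    obtain g where g: "g \<in> A" "\<epsilon> \<le> norm (\<pi> g v - v)" using far[OF v] by blast
    have "C g \<le> M" using member_le_sum[of g A C] g(1) A(1) C(1) by (simp add: M_def)
    hence "\<epsilon> \<le> M * sqrt (E v)"
      using g C(2)[OF g(1), of v] mult_right_mono[of "C g" M "sqrt (E v)"] E_nonneg by force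
    hence "\<epsilon> / M \<le> sqrt (E v)" using M by (simp add: field_simps)
    hence "(\<epsilon> / M)\<^sup>2 \<le> (sqrt (E v))\<^sup>2" using \<epsilon> M by (intro power_mono) auto
    thus ?thesis using E_nonneg by simp
  qed
  have "(\<epsilon> / M)\<^sup>2 * (norm v)\<^sup>2 \<le> E v" for v
  proof (cases "v = 0")
    case True
    thus ?thesis using E_nonneg by simp
  next
    case False
    define u where "u = (1 / norm v) *\<^sub>R v"
    have u: "norm u = 1" "v = norm v *\<^sub>R u" using False by (auto simp: u_def)
    have "E (r *\<^sub>R u) = r\<^sup>2 * E u" for r
    proof -
      have "\<pi> s (r *\<^sub>R u) - r *\<^sub>R u = r *\<^sub>R (\<pi> s u - u)" if "s \<in> S" for s
        using that assms(2) by (auto simp: rep_scaleR scaleR_diff_right)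
      thus ?thesis by (simp add: E_def sum_distrib_left power_mult_distrib)
    qed
    hence "E v = (norm v)\<^sup>2 * E u" using u(2) by metis
    thus ?thesis using mult_right_mono[OF unit[OF u(1)], of "(norm v)\<^sup>2"] by (simp add: mult.commute)
  qed
  thus ?thesis using M \<epsilon> unfolding E_def by (intro exI[of _ "(\<epsilon> / M)\<^sup>2"]) auto
qed

text \<open>
  Adding the coboundary of \<open>v\<close> lowers the sum of \<open>b\<close> over \<open>S\<close> by \<open>T v\<close>, where
  \<open>T v = (\<Sum>s\<in>S. v - \<pi> s v)\<close>. Since \<open>\<parallel>\<pi> s v - v\<parallel>\<^sup>2 = 2 * inner (v - \<pi> s v) v\<close>, the spectral
  gap is exactly the coercivity of \<open>T\<close>, so every sum can be cancelled.
\<close>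

lemma harmonic_representative:
  assumes "finite S" and "S \<subseteq> carrier G" and "generate G S = carrier G"
    and "\<not> almost_invariant_vectors G \<pi>"
  shows "\<exists>v. (\<Sum>s\<in>S. b s + (\<pi> s v - v)) = 0"
proof -
  define T where "T v = (\<Sum>s\<in>S. v - \<pi> s v)" for v
  obtain \<kappa> where \<kappa>: "\<kappa> > 0" "\<And>v. \<kappa> * (norm v)\<^sup>2 \<le> (\<Sum>s\<in>S. (norm (\<pi> s v - v))\<^sup>2)"
    using spectral_gap[OF assms] by blast
  have "bounded_linear T"
    unfolding T_def using assms(2)
    by (intro bounded_linear_sum bounded_linear_sub bounded_linear_ident rep_bounded_linear) auto
  moreover have "\<kappa> / 2 * (norm v)\<^sup>2 \<le> inner (T v) v" for v
  proof -
    have "(norm (\<pi> s v - v))\<^sup>2 = 2 * inner (v - \<pi> s v) v" if "s \<in> S" for s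
      using that assms(2) rep_inner[of s v v]
      by (auto simp: power2_norm_eq_inner inner_diff_left inner_diff_right inner_commute)
    hence "(\<Sum>s\<in>S. (norm (\<pi> s v - v))\<^sup>2) = 2 * inner (T v) v"
      by (simp add: T_def inner_sum_left sum_distrib_left)
    thus ?thesis using \<kappa>(2)[of v] by simp
  qed
  ultimately have "surj T" using \<kappa>(1) by (intro coercive_operator_surj[of T "\<kappa> / 2"]) auto
  then obtain v where "T v = (\<Sum>s\<in>S. b s)" by (metis surjD)
  moreover have "(\<Sum>s\<in>S. b s + (\<pi> s v - v)) = (\<Sum>s\<in>S. b s) - T v"
    by (simp add: T_def sum.distrib sum_subtractf)
  ultimately have "(\<Sum>s\<in>S. b s + (\<pi> s v - v)) = 0" by simp
  thus ?thesis by blast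
qed

text \<open>
  Expanding \<open>\<parallel>h g + \<pi> g (h s)\<parallel>\<^sup>2\<close> and summing over \<open>S\<close>, the cross terms add up to twice the inner
  product of \<open>h g\<close> with \<open>\<pi> g (\<Sum>s\<in>S. h s)\<close>, which is zero; what remains beyond \<open>\<parallel>h g\<parallel>\<^sup>2\<close> is
  independent of \<open>g\<close>.
\<close>

lemma laplacian_harmonic_cocycle:
  assumes "finite S" and "S \<noteq> {}" and "S \<subseteq> carrier G"
    and h: "h \<in> cocycles G \<pi>" and harmonic: "(\<Sum>s\<in>S. h s) = 0" and g: "g \<in> carrier G"
  shows "laplacian G S (\<lambda>x. c * (norm (h x))\<^sup>2) g = c * (\<Sum>s\<in>S. (norm (h s))\<^sup>2) / card S"
proof -
  have term_eq: "(norm (h (g \<otimes> s)))\<^sup>2 = (norm (h g))\<^sup>2 + (norm (h s))\<^sup>2 + 2 * inner (h g) (\<pi> g (h s))"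
    if "s \<in> S" for s
  proof -
    have "s \<in> carrier G" using that assms(3) by auto
    thus ?thesis using cocycleD[OF h g, of s] g
      by (simp add: power2_norm_eq_inner inner_add_left inner_add_right rep_inner inner_commute)
  qed
  have "(\<Sum>s\<in>S. inner (h g) (\<pi> g (h s))) = inner (h g) (\<pi> g (\<Sum>s\<in>S. h s))"
    by (simp add: rep_sum[OF g] inner_sum_right)
  also have "\<dots> = 0" using g by (simp add: harmonic rep_zero)
  finally have "(\<Sum>s\<in>S. (norm (h (g \<otimes> s)))\<^sup>2) = card S * (norm (h g))\<^sup>2 + (\<Sum>s\<in>S. (norm (h s))\<^sup>2)"
    by (simp add: term_eq sum.distrib flip: sum_distrib_left)
  moreover have "real (card S) > 0" using assms(1,2) by (simp add: card_gt_0_iff)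
  ultimately show ?thesis
    by (simp add: laplacian_def field_simps flip: sum_distrib_left)
qed

end


section \<open>Equivariant embeddings and control functions\<close>

lemma (in unitary_representation) equivariant_embedding_cocycle:
  assumes "equivariant_embedding G len \<pi> F"
  shows "(\<lambda>g. F g - F \<one>) \<in> cocycles G \<pi>"
proof -
  obtain \<alpha> where \<alpha>: "\<And>g x. g \<in> carrier G \<Longrightarrow> x \<in> carrier G \<Longrightarrow> F (g \<otimes> x) = \<alpha> g (F x)"
    "\<And>g. g \<in> carrier G \<Longrightarrow> \<exists>w. \<forall>v. \<alpha> g v = \<pi> g v + w"
    using assms unfolding equivariant_embedding_def affine_action_def by blast
  have "F (g \<otimes> h) - F \<one> = \<pi> g (F h - F \<one>) + (F g - F \<one>)"
    if g: "g \<in> carrier G" and h: "h \<in> carrier G" for g h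
  proof -
    obtain w where "\<And>v. \<alpha> g v = \<pi> g v + w" using \<alpha>(2)[OF g] by blast
    thus ?thesis using \<alpha>(1)[OF g h] \<alpha>(1)[OF g one_closed] g by (simp add: rep_diff)
  qed
  thus ?thesis by (simp add: cocycles_def)
qed

lemma (in unitary_representation) equivariant_embedding_dist:
  assumes "equivariant_embedding G len \<pi> F" and "x \<in> carrier G" and "y \<in> carrier G"
  shows "norm (F x - F y) = norm (F (inv x \<otimes> y) - F \<one>)"
proof -
  have "F (x \<otimes> (inv x \<otimes> y)) - F \<one> = \<pi> x (F (inv x \<otimes> y) - F \<one>) + (F x - F \<one>)"
    using cocycleD[OF equivariant_embedding_cocycle[OF assms(1)], of x "inv x \<otimes> y"] assms(2,3)
    by simp
  moreover have "x \<otimes> (inv x \<otimes> y) = y" using assms(2,3) by (simp flip: m_assoc)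
  ultimately have "F y - F x = \<pi> x (F (inv x \<otimes> y) - F \<one>)" by simp
  thus ?thesis using rep_norm[OF assms(2)] by (metis norm_minus_commute)
qed

lemma lower_control_le:
  fixes G (structure)
  assumes "group G" and "length_function G len" and "control_functions G len F \<rho>m \<rho>p"
    and "g \<in> carrier G"
  shows "\<rho>m (len g) \<le> norm (F g - F \<one>)"
proof -
  interpret group G by fact
  have "\<rho>m (group_dist G len g \<one>) \<le> norm (F g - F \<one>)"
    using assms(3,4) unfolding control_functions_def by blast
  moreover have "group_dist G len g \<one> = len g"
    using assms(2,4) by (simp add: group_dist_def length_function_def)
  ultimately show ?thesis by simp
qed

text \<open>
  By equivariance, distances in the image depend only on \<open>x\<inverse> y\<close>, so the spherical infimum of
  \<open>\<parallel>F g - F \<one>\<parallel>\<close> is itself admissible as a lower control function, once it is extended to values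
  that are not lengths by any function tending to infinity; here by the identity. Any largest
  lower control function therefore dominates every bound valid on a whole sphere.
\<close>

lemma (in unitary_representation) lower_control_function_greatest:
  assumes len: "length_function G len"
    and emb: "equivariant_embedding G len \<pi> F"
    and low: "lower_control_function G len F \<rho>"
    and t: "t \<in> len ` carrier G"
    and bound: "\<And>g. g \<in> carrier G \<Longrightarrow> len g = t \<Longrightarrow> m \<le> norm (F g - F \<one>)"
  shows "m \<le> \<rho> t"
proof -
  obtain \<rho>p where ctrl: "control_functions G len F \<rho> \<rho>p"
    and maximal: "\<And>\<rho>' \<rho>p' t. control_functions G len F \<rho>' \<rho>p' \<Longrightarrow> t \<in> len ` carrier G \<Longrightarrow> \<rho>' t \<le> \<rho> t"
    using low unfolding lower_control_function_def by blast
  define N where "N u = {norm (F g - F \<one>) | g. g \<in> carrier G \<and> len g = u}" for u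
  define \<sigma> where "\<sigma> u = (if u \<in> len ` carrier G then Inf (N u) else u)" for u
  have ne: "N u \<noteq> {}" if "u \<in> len ` carrier G" for u using that by (auto simp: N_def)
  have \<sigma>_ge: "min (\<rho> u) u \<le> \<sigma> u" for u
  proof (cases "u \<in> len ` carrier G")
    case True
    have "\<rho> u \<le> Inf (N u)"
      using ne[OF True] by (rule cInf_greatest)
        (use lower_control_le[OF is_group len ctrl] in \<open>auto simp: N_def\<close>)
    thus ?thesis using True by (simp add: \<sigma>_def)
  qed (simp add: \<sigma>_def)
  have "filterlim (\<lambda>u. min (\<rho> u) u) at_top at_top"
    using ctrl unfolding control_functions_def
    by (auto simp: filterlim_at_top min_le_iff_disj eventually_conj_iff eventually_ge_at_top)
  hence lim: "filterlim \<sigma> at_top at_top"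
    by (rule filterlim_at_top_mono) (simp add: \<sigma>_ge)
  have "\<sigma> (group_dist G len x y) \<le> norm (F x - F y)" if x: "x \<in> carrier G" and y: "y \<in> carrier G" for x y
  proof -
    have z: "inv x \<otimes> y \<in> carrier G" using x y by simp
    have "bdd_below (N u)" for u by (rule bdd_belowI[of _ 0]) (auto simp: N_def)
    hence "Inf (N (len (inv x \<otimes> y))) \<le> norm (F (inv x \<otimes> y) - F \<one>)"
      using z by (intro cInf_lower) (auto simp: N_def)
    thus ?thesis using z equivariant_embedding_dist[OF emb x y]
      by (simp add: \<sigma>_def group_dist_def)
  qed
  moreover have "\<sigma> u \<ge> 0" if "u \<ge> 0" for u
    using \<sigma>_ge[of u] that ctrl unfolding control_functions_def by (smt (verit) min_def)
  ultimately have "control_functions G len F \<sigma> \<rho>p"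
    using ctrl lim unfolding control_functions_def by auto
  hence "\<sigma> t \<le> \<rho> t" using t by (rule maximal)
  moreover have "m \<le> Inf (N t)"
    using ne[OF t] bound by (intro cInf_greatest) (auto simp: N_def)
  ultimately show ?thesis using t by (simp add: \<sigma>_def)
qed

lemma (in unitary_representation) bounded_embedding_bounded_length:
  assumes len: "length_function G len" and ctrl: "control_functions G len F \<rho>m \<rho>p"
    and bounded: "\<And>g. g \<in> carrier G \<Longrightarrow> norm (F g - F \<one>) \<le> B"
  shows "\<exists>R. \<forall>g\<in>carrier G. len g \<le> R"
proof -
  have "eventually (\<lambda>t. \<rho>m t > B) at_top"
    using ctrl unfolding control_functions_def filterlim_at_top_dense by blast
  then obtain R where R: "\<And>t. t \<ge> R \<Longrightarrow> \<rho>m t > B" by (auto simp: eventually_at_top_linorder)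
  have "len g \<le> R" if "g \<in> carrier G" for g
    using lower_control_le[OF is_group len ctrl that] bounded[OF that] R[of "len g"] by force
  thus ?thesis by blast
qed


section \<open>The lower control function as a Laplace solution\<close>

theorem corollary1p4:
  fixes G :: "('g, 'm) monoid_scheme" (structure)
    and S :: "'g set"
    and len :: "'g \<Rightarrow> real"
    and \<pi> :: "'g \<Rightarrow> 'h::complex_hilbert_space \<Rightarrow> 'h"
    and F :: "'g \<Rightarrow> 'h"
    and \<rho> :: "real \<Rightarrow> real"
  assumes "group G"
    and "finite S" and "S \<subseteq> carrier G" and "\<And>s. s \<in> S \<Longrightarrow> inv s \<in> S"
    and "generate G S = carrier G"
    and "length_function G len"
    and "infinite (carrier G) \<Longrightarrow> \<forall>R. \<exists>g\<in>carrier G. R < len g"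
    and "unitary_rep G \<pi>"
    and "\<not> almost_invariant_vectors G \<pi>"
    and "H1 G \<pi> \<noteq> {coboundaries G \<pi>}"
    and "equivariant_embedding G len \<pi> F"
    and "lower_control_function G len F \<rho>"
  shows "\<exists>f\<in>laplace_solutions G S. \<exists>K>0. \<exists>A\<ge>0. \<forall>t\<in>len ` carrier G.
           (1 / K) * sphere_min G len f t - A \<le> \<rho> t \<and>
           \<rho> t \<le> K * sphere_min G len f t + A"
proof -
  interpret unitary_representation G \<pi>
    using assms(1,8) by (simp add: unitary_representation_def unitary_representation_axioms_def)
  obtain \<rho>p where ctrl: "control_functions G len F \<rho> \<rho>p"
    using assms(12) unfolding lower_control_function_def by blast
  define b where "b g = F g - F \<one>" for g
  have b: "b \<in> cocycles G \<pi>"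
    unfolding b_def by (rule equivariant_embedding_cocycle[OF assms(11)])
  obtain v where v: "(\<Sum>s\<in>S. b s + (\<pi> s v - v)) = 0"
    using harmonic_representative[OF assms(2,3,5,9)] by blast
  define h where "h g = b g + (\<pi> g v - v)" for g
  have h: "h \<in> cocycles G \<pi>"
    unfolding h_def by (rule cocycle_add_coboundary[OF b])
  have near: "norm (\<pi> g v - v) \<le> 2 * norm v" if "g \<in> carrier G" for g
    using norm_triangle_ineq4[of "\<pi> g v" v] rep_norm[OF that, of v] by simp
  have b_le: "norm (b g) \<le> norm (h g) + 2 * norm v" if "g \<in> carrier G" for g
    using near[OF that] norm_triangle_ineq4[of "h g" "\<pi> g v - v"] by (simp add: h_def)
  have h_le: "norm (h g) \<le> norm (b g) + 2 * norm v" if "g \<in> carrier G" for g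
    using near[OF that] norm_triangle_ineq[of "b g" "\<pi> g v - v"] by (simp add: h_def)

  define e where "e = (\<Sum>s\<in>S. (norm (h s))\<^sup>2)"
  have "e \<noteq> 0"
  proof
    assume "e = 0"
    hence "h s = 0" if "s \<in> S" for s
      using that assms(2) by (auto simp: e_def sum_nonneg_eq_0_iff)
    hence "h g = 0" if "g \<in> carrier G" for g
      using cocycle_eq_zero_on_generate[OF h assms(3)] that assms(5) by blast
    hence "norm (F g - F \<one>) \<le> 2 * norm v" if "g \<in> carrier G" for g
      using b_le that by (force simp: b_def)
    then obtain R where "\<forall>g\<in>carrier G. len g \<le> R"
      using bounded_embedding_bounded_length[OF assms(6) ctrl] by blast
    hence "finite (carrier G)" using assms(7) by (meson not_less)
    thus False using H1_finite assms(10) by blast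
  qed
  hence e: "e > 0" using sum_nonneg[of S "\<lambda>s. (norm (h s))\<^sup>2"] by (simp add: e_def)
  hence S: "S \<noteq> {}" by (auto simp: e_def)
  hence card_S: "real (card S) > 0" using assms(2) by (simp add: card_gt_0_iff)

  define c where "c = card S / e"
  define f where "f g = c * (norm (h g))\<^sup>2" for g
  have c: "c > 0" using e card_S by (simp add: c_def)
  have "laplacian G S f g = 1" if "g \<in> carrier G" for g
    using laplacian_harmonic_cocycle[OF assms(2) S assms(3) h _ that, of c] v e card_S
    unfolding f_def by (simp add: h_def[symmetric] e_def[symmetric] c_def)
  hence f: "f \<in> laplace_solutions G S"
    using c cocycle_one[OF h] by (simp add: laplace_solutions_def f_def)
  have sqrt_f: "sqrt (f g) = sqrt c * norm (h g)" for g
    by (simp add: f_def real_sqrt_mult)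

  define a where "a = sqrt c"
  have a: "a > 0" using c by (simp add: a_def)
  \<comment> \<open>A constant serving both for the factor \<open>a\<close> and for its inverse.\<close>
  define K where "K = max a (1 / a)"
  have K: "K > 0" "1 / K \<le> 1 / a" "1 / a \<le> K"
    using a by (auto simp: K_def less_max_iff_disj field_simps)
  have "(1 / K) * sphere_min G len f t - 2 * norm v \<le> \<rho> t \<and>
        \<rho> t \<le> K * sphere_min G len f t + 2 * norm v" if t: "t \<in> len ` carrier G" for t
  proof -
    define m where "m = sphere_min G len f t"
    have ne: "{sqrt (f g) | g. g \<in> carrier G \<and> len g = t} \<noteq> {}" using t by auto
    have m_le: "m \<le> a * norm (h g)" if "g \<in> carrier G" "len g = t" for g
      unfolding m_def sphere_min_def
      by (rule cInf_lower) (use that a in \<open>auto simp: sqrt_f a_def intro!: bdd_belowI[of _ 0]\<close>)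
    have m_nonneg: "m \<ge> 0"
      unfolding m_def sphere_min_def
      by (rule cInf_greatest[OF ne]) (use a in \<open>auto simp: sqrt_f a_def\<close>)
    have "1 / a * m - 2 * norm v \<le> \<rho> t"
    proof (rule lower_control_function_greatest[OF assms(6,11,12) t])
      fix g assume g: "g \<in> carrier G" "len g = t"
      have "1 / a * m \<le> norm (h g)" using m_le[OF g] a by (simp add: field_simps)
      thus "1 / a * m - 2 * norm v \<le> norm (F g - F \<one>)"
        using h_le[OF g(1)] by (simp add: b_def)
    qed
    moreover have "1 / K * m \<le> 1 / a * m" using K(2) m_nonneg by (rule mult_right_mono)
    moreover have "\<rho> t \<le> 1 / a * m + 2 * norm v"
    proof -
      have "a * (\<rho> t - 2 * norm v) \<le> m"
        unfolding m_def sphere_min_def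
      proof (rule cInf_greatest[OF ne])
        fix x assume "x \<in> {sqrt (f g) | g. g \<in> carrier G \<and> len g = t}"
        then obtain g where g: "g \<in> carrier G" "len g = t" and x: "x = a * norm (h g)"
          by (auto simp: sqrt_f a_def)
        have "\<rho> t - 2 * norm v \<le> norm (h g)"
          using lower_control_le[OF assms(1,6) ctrl g(1)] b_le[OF g(1)] g(2) by (simp add: b_def)
        thus "a * (\<rho> t - 2 * norm v) \<le> x" using a x by simp
      qed
      thus ?thesis using a by (simp add: field_simps)
    qed
    moreover have "1 / a * m \<le> K * m" using K(3) m_nonneg by (rule mult_right_mono)
    ultimately show ?thesis unfolding m_def by linarith
  qed
  thus ?thesis using f K(1) by (intro bexI[OF _ f] exI[of _ K] conjI exI[of _ "2 * norm v"]) auto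
qed

end
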